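(* Let $L$ be the plane graph obtained from the ladder graph $L_n=P_n\square P_2$ (standard plane embedding, outer cycle $v_1,\dots,v_n,u_n,\dots,u_1$, where $u_1,v_1,u_n,v_n$ are the vertices of degree 2) by adding the four pendant edges $u_0u_1$, $v_0v_1$, $u_nu_{n+1}$, $v_nv_{n+1}$ in the outer face, with new vertices $u_0,v_0,u_{n+1},v_{n+1}$. Then $\pi_{fl}(L)\le 6$.
   Context: A sequence $r_1\dots r_{2n}$ is a repetition if $r_i=r_{n+i}$ for all $i\le n$. In a plane graph $G$, a facial path is a path whose vertices and edges are consecutive on the boundary walk of some face of $G$. A vertex colouring is facial non-repetitive if no facial path on vertices $v_1,\dots,v_{2n}$ ($n\ge1$) has colour sequence that is a repetition. $\pi_{fl}(G)$ is the minimum $l$ such that for every assignment of lists $L(v)\subseteq\mathbb{Z}_+$ with $|L(v)|\ge l$ there is a facial non-repetitive colouring $\varphi$ with $\varphi(v)\in L(v)$ for every vertex $v$. *)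

theory Defs
  imports
    "Graph_Theory.Graph_Theory"
    "HOL-Combinatorics.Orbits"
    "HOL-Library.Extended_Nat"
begin

section \<open>Plane graphs as rotation systems\<close>

text \<open>
  A finite simple graph is a symmetric loopfree pair digraph: every edge is a pair of opposite arcs.
  An embedding is given by its rotation system: \<open>rot v w\<close> is the neighbour that
  follows \<open>w\<close> in the cyclic (counterclockwise) order of the neighbours of \<open>v\<close>.
  The boundary walks of the faces are then the orbits of the following map on arcs.
\<close>

definition face_step :: "('v \<Rightarrow> 'v \<Rightarrow> 'v) \<Rightarrow> 'v \<times> 'v \<Rightarrow> 'v \<times> 'v" where
  "face_step rot a = (snd a, rot (snd a) (fst a))"

definition boundary_walks :: "'v pair_pre_digraph \<Rightarrow> ('v \<Rightarrow> 'v \<Rightarrow> 'v) \<Rightarrow> ('v \<times> 'v) set set" where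
  "boundary_walks G rot = orbit (face_step rot) ` parcs G"

definition isolated_verts :: "'v pair_pre_digraph \<Rightarrow> 'v set" where
  "isolated_verts G = {v \<in> pverts G. \<forall>w. (v, w) \<notin> parcs G}"

text \<open>
  The last assumption says that the rotation system has genus 0. It is Euler's formula
  summed over the components, \<open>V - E + F = 2\<close> for a component with an edge, where \<open>F\<close> counts
  orbits of arcs; a single vertex has no such orbit and contributes 1 instead of 2.
  In a disconnected plane graph a face can have several boundary walks, one for each component
  on its boundary; these are precisely the orbits.
\<close>

locale plane_graph = pair_graph G for G :: "'v pair_pre_digraph" +
  fixes rot :: "'v \<Rightarrow> 'v \<Rightarrow> 'v"
  assumes rotation:
    "\<And>v. v \<in> pverts G \<Longrightarrow> {w. (v, w) \<in> parcs G} \<noteq> {} \<Longrightarrow> cyclic_on (rot v) {w. (v, w) \<in> parcs G}"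
  assumes genus_0:
    "card (pverts G) + card (boundary_walks G rot) + card (isolated_verts G)
      = card (parcs G) div 2 + 2 * card (pre_digraph.sccs_verts (with_proj G))"

section \<open>Facial non-repetitive list colourings\<close>

definition repetition :: "'a list \<Rightarrow> bool" where
  "repetition r \<longleftrightarrow> (\<exists>n\<ge>1. length r = 2 * n \<and> (\<forall>i<n. r ! i = r ! (n + i)))"

text \<open>The first \<open>k\<close> vertices of the boundary walk that starts with the arc \<open>a\<close>.\<close>

definition facial_walk :: "('v \<Rightarrow> 'v \<Rightarrow> 'v) \<Rightarrow> 'v \<times> 'v \<Rightarrow> nat \<Rightarrow> 'v list" where
  "facial_walk rot a k = map (\<lambda>j. fst ((face_step rot ^^ j) a)) [0..<k]"

text \<open>
  Paths are undirected, so both directions of traversal of a boundary walk are allowed.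
\<close>

definition facial_path :: "'v pair_pre_digraph \<Rightarrow> ('v \<Rightarrow> 'v \<Rightarrow> 'v) \<Rightarrow> 'v list \<Rightarrow> bool" where
  "facial_path G rot p \<longleftrightarrow> distinct p \<and>
     (\<exists>a\<in>parcs G. p = facial_walk rot a (length p) \<or> rev p = facial_walk rot a (length p))"

definition facial_nonrepetitive ::
    "'v pair_pre_digraph \<Rightarrow> ('v \<Rightarrow> 'v \<Rightarrow> 'v) \<Rightarrow> ('v \<Rightarrow> 'c) \<Rightarrow> bool" where
  "facial_nonrepetitive G rot \<phi> \<longleftrightarrow>
     (\<forall>p. facial_path G rot p \<longrightarrow> \<not> repetition (map \<phi> p))"

text \<open>
  Infinite lists are admitted; they need a separate clause because \<open>card\<close> is 0 on infinite sets.
\<close>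

definition facial_nonrepetitive_choosable ::
    "'v pair_pre_digraph \<Rightarrow> ('v \<Rightarrow> 'v \<Rightarrow> 'v) \<Rightarrow> nat \<Rightarrow> bool" where
  "facial_nonrepetitive_choosable G rot l \<longleftrightarrow>
     (\<forall>L :: 'v \<Rightarrow> nat set.
        (\<forall>v\<in>pverts G. L v \<subseteq> {1..} \<and> (infinite (L v) \<or> l \<le> card (L v))) \<longrightarrow>
        (\<exists>\<phi>. (\<forall>v\<in>pverts G. \<phi> v \<in> L v) \<and> facial_nonrepetitive G rot \<phi>))"

text \<open>
  With values in \<^typ>\<open>enat\<close>, the infimum is the minimum if some \<open>l\<close> qualifies and \<open>\<infinity>\<close> otherwise.
\<close>

definition pi_fl :: "'v pair_pre_digraph \<Rightarrow> ('v \<Rightarrow> 'v \<Rightarrow> 'v) \<Rightarrow> enat" where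
  "pi_fl G rot = (INF l\<in>{l. facial_nonrepetitive_choosable G rot l}. enat l)"

section \<open>The ladder with four pendant edges\<close>

datatype ladder_vertex = U nat | V nat

definition ladder_edges :: "nat \<Rightarrow> (ladder_vertex \<times> ladder_vertex) set" where
  "ladder_edges n =
     {(U i, U (i + 1)) | i. 1 \<le> i \<and> i < n} \<union> {(V i, V (i + 1)) | i. 1 \<le> i \<and> i < n} \<union>
     {(U i, V i) | i. 1 \<le> i \<and> i \<le> n}"

definition pendant_edges :: "nat \<Rightarrow> (ladder_vertex \<times> ladder_vertex) set" where
  "pendant_edges n = {(U 0, U 1), (V 0, V 1), (U n, U (n + 1)), (V n, V (n + 1))}"

definition pendant_ladder :: "nat \<Rightarrow> ladder_vertex pair_pre_digraph" where
  "pendant_ladder n =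
     \<lparr>pverts = U ` {0..n + 1} \<union> V ` {0..n + 1},
      parcs = (let E = ladder_edges n \<union> pendant_edges n in E \<union> E\<inverse>)\<rparr>"

text \<open>
  The counterclockwise rotations of the straight-line drawing with \<open>U i\<close> at \<open>(i, 1)\<close> and \<open>V i\<close>
  at \<open>(i, 0)\<close>: right, left, down around \<open>U i\<close> and right, up, left around \<open>V i\<close> for
  \<open>1 \<le> i \<le> n\<close>. The end vertices of the pendant edges have a single neighbour.
\<close>

fun pendant_ladder_rot :: "nat \<Rightarrow> ladder_vertex \<Rightarrow> ladder_vertex \<Rightarrow> ladder_vertex" where
  "pendant_ladder_rot n (U i) w =
     (if 1 \<le> i \<and> i \<le> n then
        if w = U (i + 1) then U (i - 1) else if w = U (i - 1) then V i else U (i + 1)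
      else w)"
| "pendant_ladder_rot n (V i) w =
     (if 1 \<le> i \<and> i \<le> n then
        if w = V (i + 1) then U i else if w = U i then V (i - 1) else V (i + 1)
      else w)"

text \<open>
  We check that this is a plane graph, with the bounded faces and the outer face of the drawing.
\<close>

definition square_walk :: "nat \<Rightarrow> (ladder_vertex \<times> ladder_vertex) set" where
  "square_walk i =
     {(U i, U (i + 1)), (U (i + 1), V (i + 1)), (V (i + 1), V i), (V i, U i)}"

definition outer_walk :: "nat \<Rightarrow> (ladder_vertex \<times> ladder_vertex) set" where
  "outer_walk n =
     {(U (i + 1), U i) | i. i \<le> n} \<union> {(V i, V (i + 1)) | i. i \<le> n} \<union>
     {(U 0, U 1), (U 1, V 1), (V 1, V 0), (V (n + 1), V n), (V n, U n), (U n, U (n + 1))}"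

lemma pverts_pendant_ladder:
  "U i \<in> pverts (pendant_ladder n) \<longleftrightarrow> i \<le> n + 1"
  "V i \<in> pverts (pendant_ladder n) \<longleftrightarrow> i \<le> n + 1"
  by (auto simp: pendant_ladder_def)

lemma parcs_pendant_ladder:
  assumes "n \<ge> 2"
  shows "(U i, U j) \<in> parcs (pendant_ladder n) \<longleftrightarrow> j = i + 1 \<and> i \<le> n \<or> i = j + 1 \<and> j \<le> n"
    and "(V i, V j) \<in> parcs (pendant_ladder n) \<longleftrightarrow> j = i + 1 \<and> i \<le> n \<or> i = j + 1 \<and> j \<le> n"
    and "(U i, V j) \<in> parcs (pendant_ladder n) \<longleftrightarrow> i = j \<and> 1 \<le> i \<and> i \<le> n"
    and "(V i, U j) \<in> parcs (pendant_ladder n) \<longleftrightarrow> i = j \<and> 1 \<le> i \<and> i \<le> n"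
  using assms by (auto simp: pendant_ladder_def ladder_edges_def pendant_edges_def Let_def)

lemma outer_walk_iff:
  assumes "n \<ge> 2"
  shows "(U i, U j) \<in> outer_walk n \<longleftrightarrow>
      i = j + 1 \<and> j \<le> n \<or> i = 0 \<and> j = 1 \<or> i = n \<and> j = n + 1"
    and "(V i, V j) \<in> outer_walk n \<longleftrightarrow>
      j = i + 1 \<and> i \<le> n \<or> i = 1 \<and> j = 0 \<or> i = n + 1 \<and> j = n"
    and "(U i, V j) \<in> outer_walk n \<longleftrightarrow> i = 1 \<and> j = 1"
    and "(V i, U j) \<in> outer_walk n \<longleftrightarrow> i = n \<and> j = n"
  using assms by (auto simp: outer_walk_def)

lemma square_walk_iff:
  "(U i, U j) \<in> square_walk k \<longleftrightarrow> i = k \<and> j = k + 1"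
  "(V i, V j) \<in> square_walk k \<longleftrightarrow> i = k + 1 \<and> j = k"
  "(U i, V j) \<in> square_walk k \<longleftrightarrow> i = k + 1 \<and> j = k + 1"
  "(V i, U j) \<in> square_walk k \<longleftrightarrow> i = k \<and> j = k"
  by (auto simp: square_walk_def)

lemma parcs_eq_walks:
  assumes "n \<ge> 2"
  shows "parcs (pendant_ladder n) = outer_walk n \<union> (\<Union>k\<in>{1..<n}. square_walk k)"
proof -
  have rung: "i = 1 \<or> (\<exists>k\<in>{1..<n}. i = k + 1)" if "1 \<le> i" "i \<le> n" for i
    using that by (cases "i = 1") (auto intro!: bexI[of _ "i - 1"])
  have "a \<in> parcs (pendant_ladder n) \<longleftrightarrow> a \<in> outer_walk n \<union> (\<Union>k\<in>{1..<n}. square_walk k)"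
    for a
  proof (cases a)
    case (Pair x y)
    show ?thesis
      unfolding Pair using assms rung
      by (cases x; cases y)
        (auto simp: parcs_pendant_ladder outer_walk_iff square_walk_iff)
  qed
  then show ?thesis by blast
qed

lemma face_step_Pair [simp]: "face_step rot (x, y) = (y, rot y x)"
  by (simp add: face_step_def)

lemma square_walk_cyclic:
  assumes "1 \<le> k" "k < n"
  shows "cyclic_on (face_step (pendant_ladder_rot n)) (square_walk k)"
proof -
  let ?f = "face_step (pendant_ladder_rot n)"
  have f: "?f (U k, U (k + 1)) = (U (k + 1), V (k + 1))"
      "?f (U (k + 1), V (k + 1)) = (V (k + 1), V k)"
      "?f (V (k + 1), V k) = (V k, U k)"
      "?f (V k, U k) = (U k, U (k + 1))"
    using assms by auto
  have 1: "(U (k + 1), V (k + 1)) \<in> orbit ?f (U k, U (k + 1))"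
    using orbit.base[of ?f "(U k, U (k + 1))"] f by simp
  have 2: "(V (k + 1), V k) \<in> orbit ?f (U k, U (k + 1))"
    using orbit.step[OF 1] f by simp
  have 3: "(V k, U k) \<in> orbit ?f (U k, U (k + 1))"
    using orbit.step[OF 2] f by simp
  have 4: "(U k, U (k + 1)) \<in> orbit ?f (U k, U (k + 1))"
    using orbit.step[OF 3] f by simp
  have "a \<in> square_walk k" if "a \<in> orbit ?f (U k, U (k + 1))" for a
    using that
  proof induction
    case base
    then show ?case using f by (simp add: square_walk_def)
  next
    case (step a)
    then have "a = (U k, U (k + 1)) \<or> a = (U (k + 1), V (k + 1)) \<or> a = (V (k + 1), V k) \<or> a = (V k, U k)"
      unfolding square_walk_def by blast
    with f show ?case unfolding square_walk_def by (elim disjE) (simp_all del: One_nat_def)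
  qed
  with 1 2 3 4 have "orbit ?f (U k, U (k + 1)) = square_walk k"
    unfolding square_walk_def by blast
  then show ?thesis
    by (intro cyclic_on_singleI[of "(U k, U (k + 1))"]) (auto simp: square_walk_def)
qed

lemma outer_walk_cyclic:
  assumes "n \<ge> 2"
  shows "cyclic_on (face_step (pendant_ladder_rot n)) (outer_walk n)"
proof -
  let ?f = "face_step (pendant_ladder_rot n)"
  let ?O = "orbit ?f (U 0, U 1)"
  have 1: "(U 1, V 1) \<in> ?O"
    using orbit.base[of ?f "(U 0, U 1)"] assms by simp
  have 2: "(V 1, V 0) \<in> ?O"
    using orbit.step[OF 1] assms by simp
  have lower: "(V i, V (i + 1)) \<in> ?O" if "i \<le> n" for i
    using that
  proof (induction i)
    case 0
    then show ?case using orbit.step[OF 2] assms by simp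
  next
    case (Suc i)
    then show ?case using orbit.step[of "(V i, V (i + 1))" ?f "(U 0, U 1)"] assms by simp
  qed
  have 3: "(V (n + 1), V n) \<in> ?O"
    using orbit.step[OF lower[of n]] assms by simp
  have 4: "(V n, U n) \<in> ?O"
    using orbit.step[OF 3] assms by simp
  have 5: "(U n, U (n + 1)) \<in> ?O"
    using orbit.step[OF 4] assms by simp
  have upper': "(U (n - j + 1), U (n - j)) \<in> ?O" if "j \<le> n" for j
    using that
  proof (induction j)
    case 0
    then show ?case using orbit.step[OF 5] assms by simp
  next
    case (Suc j)
    define m where "m = n - Suc j"
    have "n - j = m + 1" "n - Suc j = m" "m + 1 \<le> n" using Suc.prems by (auto simp: m_def)
    moreover from this Suc have "(U (m + 2), U (m + 1)) \<in> ?O" by simp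
    from orbit.step[OF this] have "(U (m + 1), pendant_ladder_rot n (U (m + 1)) (U (m + 2))) \<in> ?O"
      by (simp only: face_step_Pair)
    ultimately show ?case by simp
  qed
  have upper: "(U (i + 1), U i) \<in> ?O" if "i \<le> n" for i
    using upper'[of "n - i"] that by simp
  have 6: "(U 0, U 1) \<in> ?O"
    using orbit.step[OF upper[of 0]] assms by simp
  have step: "?f a \<in> outer_walk n" if a: "a \<in> outer_walk n" for a
  proof -
    consider (upper) i where "a = (U (i + 1), U i)" "i \<le> n"
      | (lower) i where "a = (V i, V (i + 1))" "i \<le> n"
      | (pendant) "a = (U 0, U 1) \<or> a = (U 1, V 1) \<or> a = (V 1, V 0) \<or>
          a = (V (n + 1), V n) \<or> a = (V n, U n) \<or> a = (U n, U (n + 1))"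
      using a unfolding outer_walk_def by blast
    then show ?thesis
    proof cases
      case upper
      then show ?thesis
        by (cases i) (simp_all add: outer_walk_iff[OF assms])
    next
      case lower
      then show ?thesis
        by (cases "i = n") (simp_all add: outer_walk_iff[OF assms])
    next
      case pendant
      then show ?thesis
        using assms by (elim disjE) (simp_all add: outer_walk_iff[OF assms])
    qed
  qed
  have "a \<in> outer_walk n" if "a \<in> ?O" for a
    using that
  proof induction
    case base
    show ?case by (rule step) (simp add: outer_walk_def)
  next
    case (step a)
    from step.IH show ?case by (rule \<open>\<And>a. a \<in> outer_walk n \<Longrightarrow> ?f a \<in> outer_walk n\<close>)
  qed
  with 1 2 3 4 5 6 lower upper have "?O = outer_walk n"
    unfolding outer_walk_def by blast
  with 6 show ?thesis
    by (intro cyclic_on_singleI[of "(U 0, U 1)"]) auto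
qed

lemma boundary_walks_pendant_ladder:
  assumes "n \<ge> 2"
  shows "boundary_walks (pendant_ladder n) (pendant_ladder_rot n)
      = insert (outer_walk n) (square_walk ` {1..<n})"
proof -
  let ?f = "face_step (pendant_ladder_rot n)"
  have 1: "orbit ?f a = outer_walk n" if "a \<in> outer_walk n" for a
    using outer_walk_cyclic[OF assms] that by (rule orbit_cyclic_eq3)
  have 2: "orbit ?f a = square_walk k" if "a \<in> square_walk k" "k \<in> {1..<n}" for a k
    using orbit_cyclic_eq3[OF square_walk_cyclic[of k n] that(1)] that(2) by simp
  have 3: "outer_walk n \<noteq> {}" "square_walk k \<noteq> {}" for k
    by (auto simp: outer_walk_def square_walk_def)
  have "orbit ?f ` outer_walk n = {outer_walk n}"
    using 1 3 by auto
  moreover have "orbit ?f ` square_walk k = {square_walk k}" if "k \<in> {1..<n}" for k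
    using 2 3(2)[of k] that by auto
  ultimately show ?thesis
    unfolding boundary_walks_def parcs_eq_walks[OF assms] image_Un image_UN by simp blast
qed

lemma card_boundary_walks_pendant_ladder:
  assumes "n \<ge> 2"
  shows "card (boundary_walks (pendant_ladder n) (pendant_ladder_rot n)) = n"
proof -
  have "inj square_walk"
    by (rule injI) (metis square_walk_iff(4))
  then have "card (square_walk ` {1..<n}) = n - 1"
    by (subst card_image) (auto intro: inj_on_subset)
  moreover have "outer_walk n \<noteq> square_walk k" for k
  proof
    assume eq: "outer_walk n = square_walk k"
    have "(U 1, V 1) \<in> outer_walk n" "(V n, U n) \<in> outer_walk n"
      by (simp_all add: outer_walk_def)
    then have "(U 1, V 1) \<in> square_walk k" "(V n, U n) \<in> square_walk k"
      unfolding eq by blast+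
    with assms show False by (simp add: square_walk_iff)
  qed
  then have "outer_walk n \<notin> square_walk ` {1..<n}" by blast
  ultimately show ?thesis
    unfolding boundary_walks_pendant_ladder[OF assms] using assms by simp
qed

lemma card_pverts_pendant_ladder: "card (pverts (pendant_ladder n)) = 2 * n + 4"
proof -
  have "card (U ` {0..n + 1}) = n + 2" "card (V ` {0..n + 1}) = n + 2"
    by (auto simp: card_image inj_on_def)
  then show ?thesis
    unfolding pendant_ladder_def by (simp, subst card_Un_disjoint) auto
qed

lemma card_parcs_pendant_ladder:
  assumes "n \<ge> 2"
  shows "card (parcs (pendant_ladder n)) = 6 * n + 4"
proof -
  define A where "A = (\<lambda>i. (U i, U (i + 1))) ` {0..n} \<union> (\<lambda>i. (V i, V (i + 1))) ` {0..n} \<union>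
    (\<lambda>i. (U i, V i)) ` {1..n}"
  have "parcs (pendant_ladder n) = A \<union> A\<inverse>"
  proof -
    have "a \<in> parcs (pendant_ladder n) \<longleftrightarrow> a \<in> A \<union> A\<inverse>" for a
    proof (cases a)
      case (Pair x y)
      then show ?thesis
        by (cases x; cases y) (auto simp: parcs_pendant_ladder[OF assms] A_def)
    qed
    then show ?thesis by blast
  qed
  moreover have "card A = 3 * n + 2"
  proof -
    have "card ((\<lambda>i. (U i, U (i + 1))) ` {0..n}) = n + 1"
      "card ((\<lambda>i. (V i, V (i + 1))) ` {0..n}) = n + 1"
      "card ((\<lambda>i. (U i, V i)) ` {1..n}) = n"
      by (auto simp: card_image inj_on_def)
    then show ?thesis
      unfolding A_def by (subst card_Un_disjoint; (subst card_Un_disjoint)?) auto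
  qed
  moreover have "card (A\<inverse>) = card A" by (rule card_inverse)
  moreover have "finite A" "A \<inter> A\<inverse> = {}"
    by (auto simp: A_def)
  ultimately show ?thesis by (simp add: card_Un_disjoint)
qed

lemma pair_graph_pendant_ladder:
  assumes "n \<ge> 2"
  shows "pair_graph (pendant_ladder n)"
proof
  fix e
  assume e: "e \<in> parcs (pendant_ladder n)"
  obtain x y where [simp]: "e = (x, y)" by (cases e)
  show "fst e \<in> pverts (pendant_ladder n)" "snd e \<in> pverts (pendant_ladder n)" "fst e \<noteq> snd e"
    using e by (cases x; cases y;
        auto simp: parcs_pendant_ladder[OF assms] pverts_pendant_ladder)+
next
  show "finite (pverts (pendant_ladder n))" by (simp add: pendant_ladder_def)
  show "finite (parcs (pendant_ladder n))"
    by (rule card_ge_0_finite) (simp add: card_parcs_pendant_ladder[OF assms])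
  show "symmetric (with_proj (pendant_ladder n))"
    by (auto simp: symmetric_def pendant_ladder_def Let_def intro: symI)
qed

lemma reachable_pendant_ladder:
  assumes "n \<ge> 2" "x \<in> pverts (pendant_ladder n)" "y \<in> pverts (pendant_ladder n)"
  shows "x \<rightarrow>\<^sup>*\<^bsub>with_proj (pendant_ladder n)\<^esub> y"
proof -
  interpret pair_graph "pendant_ladder n" by (rule pair_graph_pendant_ladder[OF assms(1)])
  let ?G = "with_proj (pendant_ladder n)"
  have u: "U 0 \<rightarrow>\<^sup>*\<^bsub>?G\<^esub> U i" if "i \<le> n + 1" for i
    using that
  proof (induction i)
    case 0
    then show ?case by (simp add: pverts_pendant_ladder)
  next
    case (Suc i)
    then have "(U i, U (Suc i)) \<in> parcs (pendant_ladder n)" "U 0 \<rightarrow>\<^sup>*\<^bsub>?G\<^esub> U i"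
      by (simp_all add: parcs_pendant_ladder[OF assms(1)])
    then show ?case by (blast intro: reachable_adj_trans)
  qed
  have v: "V 0 \<rightarrow>\<^sup>*\<^bsub>?G\<^esub> V i" if "i \<le> n + 1" for i
    using that
  proof (induction i)
    case 0
    then show ?case by (simp add: pverts_pendant_ladder)
  next
    case (Suc i)
    then have "(V i, V (Suc i)) \<in> parcs (pendant_ladder n)" "V 0 \<rightarrow>\<^sup>*\<^bsub>?G\<^esub> V i"
      by (simp_all add: parcs_pendant_ladder[OF assms(1)])
    then show ?case by (blast intro: reachable_adj_trans)
  qed
  have "U 0 \<rightarrow>\<^sup>*\<^bsub>?G\<^esub> V 1"
  proof (rule reachable_adj_trans)
    show "U 0 \<rightarrow>\<^sup>*\<^bsub>?G\<^esub> U 1" using assms(1) by (intro u) simp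
    show "(U 1, V 1) \<in> parcs (pendant_ladder n)"
      using assms(1) by (simp add: parcs_pendant_ladder)
  qed
  moreover have "V 1 \<rightarrow>\<^sup>*\<^bsub>?G\<^esub> V 0"
    by (rule symmetric_reachable[OF sym_arcs], rule v) (use assms(1) in simp)
  ultimately have "U 0 \<rightarrow>\<^sup>*\<^bsub>?G\<^esub> V 0" by (rule reachable_trans)
  then have "U 0 \<rightarrow>\<^sup>*\<^bsub>?G\<^esub> z" if "z \<in> pverts (pendant_ladder n)" for z
  proof (cases z)
    case (U i)
    then show ?thesis using that u by (simp add: pverts_pendant_ladder)
  next
    case (V i)
    then have "V 0 \<rightarrow>\<^sup>*\<^bsub>?G\<^esub> z" using that v by (simp add: pverts_pendant_ladder)
    with \<open>U 0 \<rightarrow>\<^sup>*\<^bsub>?G\<^esub> V 0\<close> show ?thesis by (rule reachable_trans)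
  qed
  then have "U 0 \<rightarrow>\<^sup>*\<^bsub>?G\<^esub> x" "U 0 \<rightarrow>\<^sup>*\<^bsub>?G\<^esub> y"
    using assms by blast+
  then show ?thesis
    using reachable_trans[OF symmetric_reachable[OF sym_arcs]] by metis
qed

lemma cyclic_on_three_steps:
  assumes "g (g (g a)) = a"
  shows "cyclic_on g {a, g a, g (g a)}"
proof -
  have "z \<in> {a, g a, g (g a)}" if "z \<in> orbit g a" for z
    using that assms by induction auto
  moreover have "g a \<in> orbit g a" "g (g a) \<in> orbit g a" "g (g (g a)) \<in> orbit g a"
    by (auto intro: orbit.intros)
  ultimately have "{a, g a, g (g a)} = orbit g a" using assms by auto
  then show ?thesis by (intro cyclic_on_singleI[of a]) auto
qed

theorem plane_graph_pendant_ladder: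
  assumes "n \<ge> 2"
  shows "plane_graph (pendant_ladder n) (pendant_ladder_rot n)"
proof -
  interpret pair_graph "pendant_ladder n" by (rule pair_graph_pendant_ladder[OF assms])
  have rot: "cyclic_on (pendant_ladder_rot n x) {y. (x, y) \<in> parcs (pendant_ladder n)}"
    if "x \<in> pverts (pendant_ladder n)" for x
  proof -
    let ?g = "pendant_ladder_rot n x"
    define a where "a = (case x of U i \<Rightarrow> if i \<le> n then U (i + 1) else U n
      | V i \<Rightarrow> if i \<le> n then V (i + 1) else V n)"
    have "?g (?g (?g a)) = a"
      using that by (cases x) (auto simp: a_def)
    moreover have "{y. (x, y) \<in> parcs (pendant_ladder n)} = {a, ?g a, ?g (?g a)}"
    proof -
      have "(x, y) \<in> parcs (pendant_ladder n) \<longleftrightarrow> y \<in> {a, ?g a, ?g (?g a)}" for y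
        using that by (cases x; cases y)
          (auto simp: a_def parcs_pendant_ladder[OF assms] pverts_pendant_ladder)
      then show ?thesis by blast
    qed
    ultimately show ?thesis using cyclic_on_three_steps[of ?g a] by simp
  qed
  have iso: "isolated_verts (pendant_ladder n) = {}"
    using rot by (auto simp: isolated_verts_def cyclic_on_def)
  have scc: "sccs_verts = {pverts (pendant_ladder n)}"
  proof -
    have "scc_of x = pverts (pendant_ladder n)" if "x \<in> pverts (pendant_ladder n)" for x
      using that reachable_pendant_ladder[OF assms]
      by (auto simp: scc_of_def elim: reachable_in_vertsE)
    moreover have "U 0 \<in> pverts (pendant_ladder n)" by (simp add: pverts_pendant_ladder)
    ultimately show ?thesis unfolding sccs_verts_conv_scc_of by auto
  qed
  show ?thesis
  proof
    show "cyclic_on (pendant_ladder_rot n v) {w. (v, w) \<in> parcs (pendant_ladder n)}"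
      if "v \<in> pverts (pendant_ladder n)" for v
      using rot that .
    show "card (pverts (pendant_ladder n))
        + card (boundary_walks (pendant_ladder n) (pendant_ladder_rot n))
        + card (isolated_verts (pendant_ladder n))
      = card (parcs (pendant_ladder n)) div 2 + 2 * card sccs_verts"
      by (simp add: iso scc card_pverts_pendant_ladder card_parcs_pendant_ladder[OF assms]
          card_boundary_walks_pendant_ladder[OF assms])
  qed
qed

end

theory Submission
  imports Defs "HOL-Library.Sublist"
begin

text \<open>
  The pendant edges cut the outer boundary walk, so that every facial path is a factor of one of the
  paths \<open>U 0, \<dots>, U (n + 1)\<close> and \<open>V 0, \<dots>, V (n + 1)\<close>, or has at most four vertices, all
  on one square (at the ends of the ladder, a square with one side missing).
  Colour the first path non-repetitively from its lists, then the second one after removing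
  the colours of \<open>U i\<close> and \<open>U (i - 1)\<close> from the list of \<open>V i\<close>. This takes care of rungs and squares,
  and leaves at least four colours, which suffice for a path: by Rosenfeld's counting argument, the
  number of non-repetitive words at least doubles with each new letter.
\<close>

section \<open>Squares and non-repetitive words\<close>

lemma repetition_iff: "repetition r \<longleftrightarrow> (\<exists>u. u \<noteq> [] \<and> r = u @ u)"
proof
  assume "repetition r"
  then obtain n where n: "n \<ge> 1" "length r = 2 * n" "\<And>i. i < n \<Longrightarrow> r ! i = r ! (n + i)"
    by (auto simp: repetition_def)
  then have "take n r = drop n r"
    by (intro nth_equalityI) auto
  then have "r = take n r @ take n r"
    by (metis append_take_drop_id)
  moreover have "take n r \<noteq> []" using n by auto
  ultimately show "\<exists>u. u \<noteq> [] \<and> r = u @ u" by blast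
next
  assume "\<exists>u. u \<noteq> [] \<and> r = u @ u"
  then obtain u where "u \<noteq> []" "r = u @ u" by blast
  then show "repetition r"
    unfolding repetition_def
    by (intro exI[of _ "length u"]) (auto simp: nth_append Suc_le_eq)
qed

lemma repetition_rev [simp]: "repetition (rev r) \<longleftrightarrow> repetition r"
  unfolding repetition_iff by (metis rev_append rev_is_Nil_conv rev_rev_ident)

lemma repetition_short [simp]:
  "\<not> repetition []" "\<not> repetition [x]" "repetition [x, y] \<longleftrightarrow> x = y"
  "\<not> repetition [x, y, z]" "repetition [x, y, z, t] \<longleftrightarrow> x = z \<and> y = t"
  by (auto simp: repetition_iff Cons_eq_append_conv)

definition nonrepetitive :: "'c list \<Rightarrow> bool" where
  "nonrepetitive xs \<longleftrightarrow> (\<forall>ys. sublist ys xs \<longrightarrow> \<not> repetition ys)"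

lemma nonrepetitive_Nil [simp]: "nonrepetitive []"
  by (simp add: nonrepetitive_def repetition_iff)

lemma nonrepetitive_appendD: "nonrepetitive (xs @ ys) \<Longrightarrow> nonrepetitive xs"
  unfolding nonrepetitive_def by (meson sublist_append sublist_order.order.trans sublist_append_rightI)

text \<open>A factor of \<open>xs @ [c]\<close> that is not already a factor of \<open>xs\<close> is
  a suffix, so a new letter can create squares only at the end.\<close>

lemma nonrepetitive_snoc:
  "nonrepetitive (xs @ [c]) \<longleftrightarrow>
     nonrepetitive xs \<and> \<not> (\<exists>p u. u \<noteq> [] \<and> xs @ [c] = p @ u @ u)"
  unfolding nonrepetitive_def repetition_iff sublist_snoc suffix_def by metis

section \<open>Counting non-repetitive words with letters from given lists\<close>

definition nonrepetitive_words :: "(nat \<Rightarrow> 'c set) \<Rightarrow> nat \<Rightarrow> 'c list set" where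
  "nonrepetitive_words L m =
     {xs. length xs = m \<and> (\<forall>i<m. xs ! i \<in> L i) \<and> nonrepetitive xs}"

lemma finite_nonrepetitive_words:
  assumes "\<And>i. i < m \<Longrightarrow> finite (L i)"
  shows "finite (nonrepetitive_words L m)"
proof (rule finite_subset)
  show "nonrepetitive_words L m \<subseteq> {xs. set xs \<subseteq> (\<Union>i<m. L i) \<and> length xs = m}"
    by (fastforce simp: nonrepetitive_words_def in_set_conv_nth)
  show "finite {xs. set xs \<subseteq> (\<Union>i<m. L i) \<and> length xs = m}"
    using assms by (intro finite_lists_length_eq) auto
qed

lemma card_words_ending_in_square:
  assumes "\<And>i. i \<le> m \<Longrightarrow> finite (L i)" and "1 \<le> k"
  shows "card {xs @ [c] | xs c p u. xs \<in> nonrepetitive_words L m \<and> c \<in> L m \<and>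
            length u = k \<and> xs @ [c] = p @ u @ u}
         \<le> card (nonrepetitive_words L (Suc m - k))" (is "card ?B \<le> card ?N")
proof (rule card_inj_on_le)
  show "finite ?N" using assms by (intro finite_nonrepetitive_words) auto
  show "inj_on (take (Suc m - k)) ?B"
  proof (rule inj_onI)
    fix x y
    assume "x \<in> ?B" "y \<in> ?B" and eq: "take (Suc m - k) x = take (Suc m - k) y"
    then obtain p u q v where x: "x = p @ u @ u" "length u = k" "length x = Suc m"
      and y: "y = q @ v @ v" "length v = k" "length y = Suc m"
      unfolding nonrepetitive_words_def by (smt (verit) length_append_singleton mem_Collect_eq)
    then have "Suc m - k = length (p @ u)" "Suc m - k = length (q @ v)" by auto
    with eq x y have "p @ u = q @ v"
      by (metis append.assoc append_eq_conv_conj)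
    \<comment> \<open>Both \<open>u\<close> and \<open>v\<close> are the last \<open>k\<close>
      letters of this common prefix, so \<open>u = v\<close> and \<open>p = q\<close>.\<close>
    with x y show "x = y" by simp
  qed
  show "take (Suc m - k) ` ?B \<subseteq> ?N"
  proof
    fix z
    assume "z \<in> take (Suc m - k) ` ?B"
    then obtain xs c p u where z: "z = take (Suc m - k) (xs @ [c])"
      and xs: "xs \<in> nonrepetitive_words L m" by blast
    \<comment> \<open>By \<open>1 \<le> k\<close> at least the letter \<open>c\<close> is cut off,
      which leaves a prefix of the non-repetitive word \<open>xs\<close>.\<close>
    then have z': "z = take (Suc m - k) xs" and len: "length xs = m"
      using assms(2) by (auto simp: nonrepetitive_words_def)
    have "nonrepetitive z"
      using xs nonrepetitive_appendD[of z "drop (Suc m - k) xs"]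
      by (simp add: z' nonrepetitive_words_def)
    then show "z \<in> ?N"
      using xs assms(2) by (auto simp: z' nonrepetitive_words_def)
  qed
qed

text \<open>
  Every one-letter extension that is not non-repetitive ends in a square \<open>u u\<close>, and removing the
  second \<open>u\<close> loses no information once the length of \<open>u\<close> is known.
\<close>

lemma card_nonrepetitive_words_Suc:
  assumes L: "\<And>i. i \<le> m \<Longrightarrow> finite (L i)"
  shows "card (nonrepetitive_words L m) * card (L m)
    \<le> card (nonrepetitive_words L (Suc m)) + (\<Sum>i\<le>m. card (nonrepetitive_words L i))"
proof -
  let ?N = "nonrepetitive_words L"
  let ?B = "\<lambda>k. {xs @ [c] | xs c p u. xs \<in> ?N m \<and> c \<in> L m \<and> length u = k \<and> xs @ [c] = p @ u @ u}"
  let ?E = "(\<lambda>(xs, c). xs @ [c]) ` (?N m \<times> L m)"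
  have fin: "finite (?N j)" if "j \<le> Suc m" for j
    using that L by (intro finite_nonrepetitive_words) auto
  have "card (?N m) * card (L m) = card ?E"
    by (subst card_image) (auto simp: inj_on_def card_cartesian_product)
  also have "?E \<subseteq> ?N (Suc m) \<union> (\<Union>k\<in>{1..Suc m}. ?B k)"
  proof
    fix z
    assume "z \<in> ?E"
    then obtain xs c where z: "z = xs @ [c]" and xs: "xs \<in> ?N m" and c: "c \<in> L m" by auto
    show "z \<in> ?N (Suc m) \<union> (\<Union>k\<in>{1..Suc m}. ?B k)"
    proof (cases "nonrepetitive z")
      case True
      then have "z \<in> ?N (Suc m)"
        using xs c by (auto simp: z nonrepetitive_words_def nth_append less_Suc_eq)
      then show ?thesis by blast
    next
      case False
      with xs obtain p u where u: "u \<noteq> []" "xs @ [c] = p @ u @ u"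
        by (auto simp: z nonrepetitive_snoc nonrepetitive_words_def)
      have "length (xs @ [c]) = Suc m" using xs by (simp add: nonrepetitive_words_def)
      with u have "length u \<in> {1..Suc m}" by (auto simp: Suc_le_eq)
      moreover have "z \<in> ?B (length u)" using z xs c u by blast
      ultimately show ?thesis by blast
    qed
  qed
  then have "card ?E \<le> card (?N (Suc m) \<union> (\<Union>k\<in>{1..Suc m}. ?B k))"
  proof (rule card_mono[rotated])
    have "?B k \<subseteq> ?E" for k by auto
    moreover have "finite ?E" using fin L by auto
    ultimately have "finite (?B k)" for k by (meson finite_subset)
    then show "finite (?N (Suc m) \<union> (\<Union>k\<in>{1..Suc m}. ?B k))" using fin by blast
  qed
  also have "\<dots> \<le> card (?N (Suc m)) + card (\<Union>k\<in>{1..Suc m}. ?B k)"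
    by (rule card_Un_le)
  also have "card (\<Union>k\<in>{1..Suc m}. ?B k) \<le> (\<Sum>k\<in>{1..Suc m}. card (?B k))"
    by (rule card_UN_le) simp
  also have "\<dots> \<le> (\<Sum>k\<in>{1..Suc m}. card (?N (Suc m - k)))"
    using L by (intro sum_mono card_words_ending_in_square) auto
  also have "\<dots> = (\<Sum>i\<le>m. card (?N i))"
    by (rule sum.reindex_bij_witness[of _ "\<lambda>i. Suc m - i" "\<lambda>k. Suc m - k"]) auto
  finally show ?thesis by simp
qed

lemma ex_nonrepetitive_word:
  fixes L :: "nat \<Rightarrow> 'c set"
  assumes "\<And>i. i < m \<Longrightarrow> finite (L i)" "\<And>i. i < m \<Longrightarrow> 4 \<le> card (L i)"
  shows "\<exists>f. (\<forall>i<m. f i \<in> L i) \<and> nonrepetitive (map f [0..<m])"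
proof -
  let ?N = "nonrepetitive_words L"
  \<comment> \<open>Let N_i count the words of length i and S_m = N_0 + ... + N_m. From S_m \<le> 2
    N_m follows N_(m+1) \<ge> 4 N_m - S_m \<ge> 2 N_m, hence S_(m+1) = S_m + N_(m+1) \<le> 2
    N_(m+1). In this argument growth by a factor b costs b + b/(b - 1) letters, which is least,
    namely 4, at b = 2.\<close>
  have "0 < card (?N m) \<and> (\<Sum>i\<le>m. card (?N i)) \<le> 2 * card (?N m)"
    using assms
  proof (induction m)
    case 0
    have "?N 0 = {[]}" by (auto simp: nonrepetitive_words_def)
    then show ?case by simp
  next
    case (Suc m)
    have "card (?N m) * 4 \<le> card (?N m) * card (L m)" using Suc.prems by simp
    also have "\<dots> \<le> card (?N (Suc m)) + (\<Sum>i\<le>m. card (?N i))"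
      using Suc.prems by (intro card_nonrepetitive_words_Suc) auto
    finally show ?case using Suc by fastforce
  qed
  then obtain xs where "xs \<in> ?N m" by (metis card_gt_0_iff ex_in_conv)
  then show ?thesis
    by (intro exI[of _ "nth xs"]) (auto simp: nonrepetitive_words_def map_nth)
qed

section \<open>Facial walks of the ladder\<close>

lemma facial_walk_0 [simp]: "facial_walk rot a 0 = []"
  by (simp add: facial_walk_def)

lemma facial_walk_Suc [simp]:
  "facial_walk rot a (Suc k) = fst a # facial_walk rot (face_step rot a) k"
  by (simp add: facial_walk_def upt_conv_Cons map_Suc_upt[symmetric] funpow_swap1 o_def
      del: upt_Suc face_step_Pair)

text \<open>The first five vertices of the boundary walk are \<open>x\<close>, \<open>y\<close>,
  \<open>z\<close>, \<open>t\<close>, \<open>s\<close>. As they are not distinct, a path has at most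
  four vertices, so only the lengths two and four have to be excluded.\<close>

lemma not_repetition_short_facial_walk:
  assumes "distinct (facial_walk rot (x, y) k)"
    and zts: "rot y x = z" "rot z y = t" "rot t z = s"
    and "\<not> distinct [x, y, z, t, s]" "\<phi> x \<noteq> \<phi> y"
    and diag: "distinct [x, y, z, t] \<Longrightarrow> \<phi> x \<noteq> \<phi> z \<or> \<phi> y \<noteq> \<phi> t"
  shows "\<not> repetition (map \<phi> (facial_walk rot (x, y) k))"
proof -
  have "k < 5"
  proof (rule ccontr)
    assume "\<not> k < 5"
    then obtain m where "k = 5 + m" by (metis not_less le_Suc_ex)
    then have "k = Suc (Suc (Suc (Suc (Suc m))))" by simp
    with assms(1,5) show False by (simp add: zts)
  qed
  then have "k = 0 \<or> k = Suc 0 \<or> k = Suc (Suc 0) \<or> k = Suc (Suc (Suc 0)) \<or>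
      k = Suc (Suc (Suc (Suc 0)))"
    by linarith
  with assms(1,6) diag show ?thesis by (elim disjE) (simp_all add: zts)
qed

text \<open>The walk runs straight to \<open>V (n + 1)\<close> and there turns back to
  \<open>V n\<close>; distinctness stops it before it does.\<close>

lemma facial_walk_V:
  assumes "distinct (facial_walk (pendant_ladder_rot n) (V i, V (i + 1)) k)" "i \<le> n"
  shows "facial_walk (pendant_ladder_rot n) (V i, V (i + 1)) k = map V [i..<i + k] \<and> i + k \<le> n + 2"
  using assms
proof (induction k arbitrary: i)
  case (Suc k)
  show ?case
  proof (cases "i < n")
    case True
    moreover have "[i..<i + Suc k] = i # [Suc i..<Suc i + k]"
      by (simp add: upt_conv_Cons del: upt_Suc)
    ultimately show ?thesis using Suc.IH[of "Suc i"] Suc.prems by (simp del: upt_Suc)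
  next
    case False
    with Suc.prems have "k < 2"
      by (cases k rule: nat.exhaust; cases "k - 1") (auto split: if_splits)
    with False Suc.prems show ?thesis by (auto simp: less_2_cases_iff)
  qed
qed simp

text \<open>The same in the opposite direction, with the turn at \<open>U 0\<close>. The bound
  \<open>k \<le> i + 2\<close> makes the truncated subtraction exact.\<close>

lemma facial_walk_U:
  assumes "distinct (facial_walk (pendant_ladder_rot n) (U (i + 1), U i) k)" "i \<le> n"
  shows "facial_walk (pendant_ladder_rot n) (U (i + 1), U i) k = rev (map U [i + 2 - k..<i + 2])
    \<and> k \<le> i + 2"
  using assms
proof (induction k arbitrary: i)
  case (Suc k)
  show ?case
  proof (cases i)
    case (Suc j)
    with Suc.IH[of j] Suc.prems show ?thesis by auto
  next
    case 0
    with Suc.prems have "k < 2"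
      by (cases k rule: nat.exhaust; cases "k - 1") (auto split: if_splits)
    with 0 Suc.prems show ?thesis by (auto simp: less_2_cases_iff)
  qed
qed simp

text \<open>Arcs are sorted by the boundary walk that they start: in the first two cases it follows
  one side of the ladder to its end, in the other four it revisits a vertex among its first
  five.\<close>

lemma parcs_pendant_ladder_cases:
  assumes "n \<ge> 2" "a \<in> parcs (pendant_ladder n)"
  obtains (V_right) i where "a = (V i, V (i + 1))" "i \<le> n"
    | (U_left) i where "a = (U (i + 1), U i)" "i \<le> n"
    | (U_right) i where "a = (U i, U (i + 1))" "i \<le> n"
    | (V_left) i where "a = (V (i + 1), V i)" "i \<le> n"
    | (down) i where "a = (U (i + 1), V (i + 1))" "i < n"
    | (up) i where "a = (V i, U i)" "1 \<le> i" "i \<le> n"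
proof (cases a)
  case (Pair x y)
  show ?thesis
  proof (cases x)
    case (U i)
    then show ?thesis
      using assms Pair that(2,3) that(5)[of "i - 1"] by (cases y) (auto simp: parcs_pendant_ladder)
  next
    case (V i)
    then show ?thesis
      using assms Pair that(1,4,6) by (cases y) (auto simp: parcs_pendant_ladder)
  qed
qed

text \<open>A repetition on the four vertices of a square needs both diagonals monochromatic, so it
  suffices to control the diagonal from \<open>U i\<close> to \<open>V (i + 1)\<close>. The cases
  \<open>i = 0\<close> and \<open>i = n\<close> serve the open squares at the two ends.\<close>

lemma facial_nonrepetitive_pendant_ladder:
  assumes n: "n \<ge> 2"
    and U: "nonrepetitive (map (\<lambda>i. \<phi> (U i)) [0..<n + 2])"
    and V: "nonrepetitive (map (\<lambda>i. \<phi> (V i)) [0..<n + 2])"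
    and rung: "\<And>i. 1 \<le> i \<Longrightarrow> i \<le> n \<Longrightarrow> \<phi> (V i) \<noteq> \<phi> (U i)"
    and diagonal: "\<And>i. i \<le> n \<Longrightarrow> \<phi> (V (i + 1)) \<noteq> \<phi> (U i)"
  shows "facial_nonrepetitive (pendant_ladder n) (pendant_ladder_rot n) \<phi>"
proof -
  let ?w = "facial_walk (pendant_ladder_rot n)"
  have factor: "\<not> repetition (map f [i..<j])"
    if "nonrepetitive (map f [0..<n + 2])" "j \<le> n + 2" for f :: "nat \<Rightarrow> 'a" and i j
  proof -
    have "map f [i..<j] = take (j - i) (drop i (map f [0..<n + 2]))"
      using that(2) by (cases "i \<le> j") (simp_all add: take_map drop_map del: upt_Suc)
    then have "sublist (map f [i..<j]) (map f [0..<n + 2])"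
      by (metis sublist_take sublist_drop sublist_order.order.trans)
    with that(1) show ?thesis by (auto simp: nonrepetitive_def)
  qed
  \<comment> \<open>Neighbours on one side form a factor of length two.\<close>
  have step: "\<phi> (U i) \<noteq> \<phi> (U (i + 1))" "\<phi> (V i) \<noteq> \<phi> (V (i + 1))" if "i \<le> n" for i
    using that factor[OF U, of "i + 2" i] factor[OF V, of "i + 2" i]
    by (simp_all add: upt_rec[of i])
  have "\<not> repetition (map \<phi> (?w a k))"
    if a: "a \<in> parcs (pendant_ladder n)" and d: "distinct (?w a k)" for a k
    using n a
  proof (cases rule: parcs_pendant_ladder_cases)
    case (V_right i)
    with d show ?thesis
      using facial_walk_V[of n i k] factor[OF V, of "i + k" i] by (simp add: o_def)
  next
    case (U_left i)
    with d show ?thesis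
      using facial_walk_U[of n i k] factor[OF U, of "i + 2" "i + 2 - k"]
      by (simp add: o_def rev_map[symmetric] del: upt_Suc)
  next
    case (U_right i)
    \<comment> \<open>The three \<open>refl\<close> facts let the rotation itself determine
      \<open>z\<close>, \<open>t\<close> and \<open>s\<close>.\<close>
    show ?thesis
    proof (use d in \<open>unfold U_right(1)\<close>, rule not_repetition_short_facial_walk[OF _ refl refl refl])
      show "\<phi> (U i) \<noteq> \<phi> (U (i + 1))" using step U_right(2) by blast
    qed (use n U_right(2) diagonal[of i] in \<open>auto split: if_splits\<close>)
  next
    case (V_left i)
    show ?thesis
    proof (use d in \<open>unfold V_left(1)\<close>, rule not_repetition_short_facial_walk[OF _ refl refl refl])
      show "\<phi> (V (i + 1)) \<noteq> \<phi> (V i)" using step V_left(2) by metis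
    qed (use n V_left(2) diagonal[of i] in \<open>auto split: if_splits\<close>)
  next
    case (down i)
    show ?thesis
    proof (use d in \<open>unfold down(1)\<close>, rule not_repetition_short_facial_walk[OF _ refl refl refl])
      show "\<phi> (U (i + 1)) \<noteq> \<phi> (V (i + 1))" using rung[of "i + 1"] down(2) by simp
    qed (use n down(2) diagonal[of i] in \<open>auto split: if_splits\<close>)
  next
    case (up i)
    show ?thesis
    proof (use d in \<open>unfold up(1)\<close>, rule not_repetition_short_facial_walk[OF _ refl refl refl])
      show "\<phi> (V i) \<noteq> \<phi> (U i)" using rung[of i] up by simp
    qed (use n up(2,3) diagonal[of i] in \<open>auto split: if_splits\<close>)
  qed
  \<comment> \<open>A path read against the boundary walk is the reversal of one read along it, and
    reversal preserves repetitions.\<close>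
  then show ?thesis
    unfolding facial_nonrepetitive_def facial_path_def
    by (metis distinct_rev repetition_rev rev_map)
qed

section \<open>Choice of colours from the lists\<close>

lemma facial_nonrepetitive_choosable_pendant_ladder:
  assumes n: "n \<ge> 2"
  shows "facial_nonrepetitive_choosable (pendant_ladder n) (pendant_ladder_rot n) 6"
  unfolding facial_nonrepetitive_choosable_def
proof (intro allI impI)
  fix L :: "ladder_vertex \<Rightarrow> nat set"
  assume L: "\<forall>v\<in>pverts (pendant_ladder n). L v \<subseteq> {1..} \<and> (infinite (L v) \<or> 6 \<le> card (L v))"
  \<comment> \<open>Counting words requires finite lists, so each list is cut down to six
    colours.\<close>
  have "\<exists>A. A \<subseteq> L v \<and> finite A \<and> card A = 6" if "v \<in> pverts (pendant_ladder n)" for v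
    using L that by (metis infinite_arbitrarily_large obtain_subset_with_card_n)
  then obtain M where M: "\<And>v. v \<in> pverts (pendant_ladder n) \<Longrightarrow> M v \<subseteq> L v"
    and fin: "\<And>v. v \<in> pverts (pendant_ladder n) \<Longrightarrow> finite (M v)"
    and card: "\<And>v. v \<in> pverts (pendant_ladder n) \<Longrightarrow> card (M v) = 6"
    by metis
  obtain f where f: "\<And>i. i < n + 2 \<Longrightarrow> f i \<in> M (U i)" "nonrepetitive (map f [0..<n + 2])"
    using ex_nonrepetitive_word[of "n + 2" "\<lambda>i. M (U i)"] fin card
    by (auto simp: pverts_pendant_ladder)
  \<comment> \<open>At most two colours are lost, so 6 - 2 = 4 remain. For \<open>i = 0\<close>
    truncated subtraction makes both of them \<open>f 0\<close>.\<close>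
  define K where "K i = M (V i) - {f i, f (i - 1)}" for i
  have K: "finite (K i)" "4 \<le> card (K i)" if "i < n + 2" for i
  proof -
    have "V i \<in> pverts (pendant_ladder n)" using that by (simp add: pverts_pendant_ladder)
    from fin[OF this] card[OF this] show "finite (K i)" "4 \<le> card (K i)"
      using diff_card_le_card_Diff[of "{f i, f (i - 1)}" "M (V i)"] card_insert_le_m1[of 2 "{f (i - 1)}" "f i"]
      by (auto simp: K_def)
  qed
  obtain g where g: "\<And>i. i < n + 2 \<Longrightarrow> g i \<in> K i" "nonrepetitive (map g [0..<n + 2])"
    using ex_nonrepetitive_word[of "n + 2" K] K by auto
  define \<phi> where "\<phi> v = (case v of U i \<Rightarrow> f i | V i \<Rightarrow> g i)" for v
  have "\<phi> v \<in> L v" if "v \<in> pverts (pendant_ladder n)" for v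
    using M[OF that] f(1) g(1) that
    by (cases v) (auto simp: \<phi>_def K_def pverts_pendant_ladder)
  moreover have "facial_nonrepetitive (pendant_ladder n) (pendant_ladder_rot n) \<phi>"
  proof (rule facial_nonrepetitive_pendant_ladder[OF n])
    show "\<phi> (V i) \<noteq> \<phi> (U i)" if "1 \<le> i" "i \<le> n" for i
      using g(1)[of i] that by (auto simp: \<phi>_def K_def)
    show "\<phi> (V (i + 1)) \<noteq> \<phi> (U i)" if "i \<le> n" for i
      using g(1)[of "i + 1"] that by (auto simp: \<phi>_def K_def)
  qed (use f g in \<open>simp_all add: \<phi>_def\<close>)
  ultimately show "\<exists>\<phi>. (\<forall>v\<in>pverts (pendant_ladder n). \<phi> v \<in> L v) \<and>
      facial_nonrepetitive (pendant_ladder n) (pendant_ladder_rot n) \<phi>"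
    by blast
qed

theorem theorem10:
  fixes n :: nat
  assumes "n \<ge> 2"
  shows "pi_fl (pendant_ladder n) (pendant_ladder_rot n) \<le> 6"
proof -
  have "pi_fl (pendant_ladder n) (pendant_ladder_rot n) \<le> enat 6"
    unfolding pi_fl_def
    using facial_nonrepetitive_choosable_pendant_ladder[OF assms] by (intro INF_lower) simp
  then show ?thesis by (simp add: numeral_eq_enat)
qed

end
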